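(* Let $P(5,1)$ be the graph with vertex set $\{u_0,\dots,u_4,v_0,\dots,v_4\}$ and edges $u_iu_{i+1}$, $v_iv_{i+1}$, $u_iv_i$ ($i=0,\dots,4$, indices mod $5$). Up to switching isomorphism there are exactly twelve signed graphs on $P(5,1)$; i.e., the set of all signatures $\Sigma\subseteq E(P(5,1))$ falls into exactly twelve classes under switching isomorphism.
   Context: A signature of a graph $G$ is a subset $\Sigma\subseteq E(G)$ (the negative edges). Resigning at a vertex $v$ replaces $\Sigma$ by its symmetric difference with the set of edges incident with $v$; two signatures are switching equivalent if one is obtained from the other by a sequence of resignings. Two signatures $\Sigma_1,\Sigma_2$ of $G$ are switching isomorphic if there is an automorphism $\psi$ of $G$ such that $\psi(\Sigma_1)=\{\psi(x)\psi(y):xy\in\Sigma_1\}$ is switching equivalent to $\Sigma_2$. *)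

theory Defs
  imports Main
begin

text \<open>
  A graph is given by its vertex set \<open>V\<close> and its edge set \<open>E\<close>, the edge \<open>xy\<close> being the
  two-element set \<open>{x, y}\<close>. A signature is a set \<open>\<Sigma> \<subseteq> E\<close>.
\<close>

definition simple_graph :: "'a set \<Rightarrow> 'a set set \<Rightarrow> bool" where
  "simple_graph V E \<longleftrightarrow> (\<forall>e\<in>E. e \<subseteq> V \<and> card e = 2)"

definition signatures :: "'a set set \<Rightarrow> 'a set set set" where
  "signatures E = Pow E"

definition resign :: "'a set set \<Rightarrow> 'a \<Rightarrow> 'a set set \<Rightarrow> 'a set set" where
  "resign E v \<Sigma> = sym_diff \<Sigma> {e \<in> E. v \<in> e}"

inductive switching_equivalent ::
    "'a set \<Rightarrow> 'a set set \<Rightarrow> 'a set set \<Rightarrow> 'a set set \<Rightarrow> bool" for V E where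
  refl: "switching_equivalent V E \<Sigma> \<Sigma>"
| step: "switching_equivalent V E \<Sigma>\<^sub>1 \<Sigma>\<^sub>2 \<Longrightarrow> v \<in> V
    \<Longrightarrow> switching_equivalent V E \<Sigma>\<^sub>1 (resign E v \<Sigma>\<^sub>2)"

definition graph_automorphism :: "'a set \<Rightarrow> 'a set set \<Rightarrow> ('a \<Rightarrow> 'a) \<Rightarrow> bool" where
  "graph_automorphism V E \<psi> \<longleftrightarrow>
     bij_betw \<psi> V V \<and> (\<forall>x\<in>V. \<forall>y\<in>V. {x, y} \<in> E \<longleftrightarrow> {\<psi> x, \<psi> y} \<in> E)"

definition map_signature :: "('a \<Rightarrow> 'a) \<Rightarrow> 'a set set \<Rightarrow> 'a set set" where
  "map_signature \<psi> \<Sigma> = {{\<psi> x, \<psi> y} |x y. {x, y} \<in> \<Sigma>}"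

definition switching_isomorphic ::
    "'a set \<Rightarrow> 'a set set \<Rightarrow> 'a set set \<Rightarrow> 'a set set \<Rightarrow> bool" where
  "switching_isomorphic V E \<Sigma>\<^sub>1 \<Sigma>\<^sub>2 \<longleftrightarrow>
     (\<exists>\<psi>. graph_automorphism V E \<psi> \<and> switching_equivalent V E (map_signature \<psi> \<Sigma>\<^sub>1) \<Sigma>\<^sub>2)"

definition switching_isomorphism :: "'a set \<Rightarrow> 'a set set \<Rightarrow> ('a set set \<times> 'a set set) set" where
  "switching_isomorphism V E =
     {(\<Sigma>\<^sub>1, \<Sigma>\<^sub>2). \<Sigma>\<^sub>1 \<in> signatures E \<and> \<Sigma>\<^sub>2 \<in> signatures E \<and> switching_isomorphic V E \<Sigma>\<^sub>1 \<Sigma>\<^sub>2}"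

lemma resign_signature: "\<Sigma> \<subseteq> E \<Longrightarrow> resign E v \<Sigma> \<subseteq> E"
  by (auto simp: resign_def)

lemma resign_resign: "resign E v (resign E v \<Sigma>) = \<Sigma>"
  by (auto simp: resign_def)

lemma switching_equivalent_trans:
  assumes "switching_equivalent V E B C" "switching_equivalent V E A B"
  shows "switching_equivalent V E A C"
  using assms by induction (auto intro: switching_equivalent.step)

lemma switching_equivalent_sym:
  assumes "switching_equivalent V E A B"
  shows "switching_equivalent V E B A"
  using assms
proof induction
  case (refl \<Sigma>)
  show ?case by (rule switching_equivalent.refl)
next
  case (step A B v)
  have "switching_equivalent V E (resign E v B) (resign E v (resign E v B))"
    using step.hyps by (intro switching_equivalent.step switching_equivalent.refl)
  then show ?case
    unfolding resign_resign using step.IH by (rule switching_equivalent_trans[rotated])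
qed

lemma map_signature_image:
  assumes "simple_graph V E" "\<Sigma> \<subseteq> E"
  shows "map_signature \<psi> \<Sigma> = (`) \<psi> ` \<Sigma>"
proof (intro equalityI subsetI)
  fix e assume "e \<in> (`) \<psi> ` \<Sigma>"
  then obtain d where d: "d \<in> \<Sigma>" "e = \<psi> ` d" by blast
  then have "card d = 2" using assms by (auto simp: simple_graph_def)
  then obtain x y where "d = {x, y}" unfolding card_2_iff by blast
  then have "e = {\<psi> x, \<psi> y}" "{x, y} \<in> \<Sigma>" using d by simp_all
  then show "e \<in> map_signature \<psi> \<Sigma>" unfolding map_signature_def by blast
next
  fix e assume "e \<in> map_signature \<psi> \<Sigma>"
  then obtain x y where "e = {\<psi> x, \<psi> y}" "{x, y} \<in> \<Sigma>"
    unfolding map_signature_def by blast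
  then have "e = \<psi> ` {x, y}" "{x, y} \<in> \<Sigma>" by simp_all
  then show "e \<in> (`) \<psi> ` \<Sigma>" by (rule image_eqI)
qed

lemma graph_automorphism_edge_iff:
  assumes "simple_graph V E" "graph_automorphism V E \<psi>" "e \<subseteq> V"
  shows "\<psi> ` e \<in> E \<longleftrightarrow> e \<in> E"
proof -
  have inj: "inj_on \<psi> e"
    using assms(2,3) unfolding graph_automorphism_def bij_betw_def by (blast intro: inj_on_subset)
  show ?thesis
  proof (cases "card e = 2")
    case True
    then obtain x y where e: "e = {x, y}" unfolding card_2_iff by blast
    have "{x, y} \<in> E \<longleftrightarrow> {\<psi> x, \<psi> y} \<in> E"
      using assms(2,3) e unfolding graph_automorphism_def by blast
    then show ?thesis by (simp add: e)
  next
    case False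
    then have "card (\<psi> ` e) \<noteq> 2" using card_image[OF inj] by simp
    then show ?thesis using False assms(1) unfolding simple_graph_def by blast
  qed
qed

lemma map_signature_subset:
  assumes "simple_graph V E" "graph_automorphism V E \<psi>" "\<Sigma> \<subseteq> E"
  shows "map_signature \<psi> \<Sigma> \<subseteq> E"
proof -
  have "\<psi> ` e \<in> E" if "e \<in> \<Sigma>" for e
  proof -
    have "e \<in> E" "e \<subseteq> V" using that assms(1,3) by (auto simp: simple_graph_def)
    then show ?thesis using graph_automorphism_edge_iff[OF assms(1,2)] by blast
  qed
  then show ?thesis unfolding map_signature_image[OF assms(1,3)] by blast
qed

lemma graph_automorphism_id: "graph_automorphism V E id"
  by (simp add: graph_automorphism_def)

lemma graph_automorphism_comp:
  assumes "graph_automorphism V E f" "graph_automorphism V E g"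
  shows "graph_automorphism V E (g \<circ> f)"
proof -
  have "f x \<in> V" if "x \<in> V" for x
    using assms(1) that unfolding graph_automorphism_def by (blast dest: bij_betwE)
  moreover have "bij_betw (g \<circ> f) V V"
    using assms by (meson bij_betw_trans graph_automorphism_def)
  ultimately show ?thesis
    using assms unfolding graph_automorphism_def comp_apply by metis
qed

lemma graph_automorphism_inv:
  assumes "graph_automorphism V E f"
  shows "graph_automorphism V E (inv_into V f)"
proof -
  have f: "bij_betw f V V" using assms by (simp add: graph_automorphism_def)
  have g: "bij_betw (inv_into V f) V V" by (rule bij_betw_inv_into[OF f])
  have "inv_into V f x \<in> V" "f (inv_into V f x) = x" if "x \<in> V" for x
    using that bij_betwE[OF g] bij_betw_inv_into_right[OF f] by blast+
  then show ?thesis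
    using assms g unfolding graph_automorphism_def by metis
qed

lemma map_signature_resign:
  assumes "simple_graph V E" "graph_automorphism V E \<psi>" "\<Sigma> \<subseteq> E" "v \<in> V"
  shows "map_signature \<psi> (resign E v \<Sigma>) = resign E (\<psi> v) (map_signature \<psi> \<Sigma>)"
proof -
  have sub: "e \<subseteq> V" if "e \<in> E" for e using assms(1) that by (auto simp: simple_graph_def)
  have inj: "inj_on \<psi> V" and im: "\<psi> ` V = V"
    using assms(2) unfolding graph_automorphism_def bij_betw_def by blast+
  have injE: "inj_on ((`) \<psi>) E"
    by (rule inj_on_subset[OF inj_on_image_Pow[OF inj]]) (auto dest: sub)
  have "(`) \<psi> ` {e \<in> E. v \<in> e} = {e \<in> E. \<psi> v \<in> e}" (is "?L = ?R")
  proof (intro equalityI subsetI)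
    fix d assume "d \<in> ?L"
    then obtain e where e: "e \<in> E" "v \<in> e" "d = \<psi> ` e" by blast
    then have "d \<in> E"
      using graph_automorphism_edge_iff[OF assms(1,2) sub[OF e(1)]] by simp
    then show "d \<in> ?R" using e by blast
  next
    fix d assume d: "d \<in> ?R"
    then have "d \<subseteq> \<psi> ` V" using sub im by simp
    then obtain e where e: "e \<subseteq> V" "d = \<psi> ` e" by (rule subset_imageE)
    have "e \<in> E" using d e(2) graph_automorphism_edge_iff[OF assms(1,2) e(1)] by simp
    moreover have "v \<in> e" using d e(2) inj_on_image_mem_iff[OF inj assms(4) e(1)] by simp
    ultimately show "d \<in> ?L" using e by blast
  qed
  moreover have "(`) \<psi> ` (A - B) = (`) \<psi> ` A - (`) \<psi> ` B" if "A \<subseteq> E" "B \<subseteq> E" for A B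
    using that by (intro inj_on_image_set_diff[OF injE]) auto
  ultimately show ?thesis
    unfolding map_signature_image[OF assms(1) resign_signature[OF assms(3)]]
      map_signature_image[OF assms(1,3)]
    using assms(3) by (simp add: resign_def image_Un)
qed

lemma switching_equivalent_map_signature:
  assumes "switching_equivalent V E A B"
    "simple_graph V E" "graph_automorphism V E \<psi>" "A \<subseteq> E"
  shows "B \<subseteq> E \<and> switching_equivalent V E (map_signature \<psi> A) (map_signature \<psi> B)"
  using assms
proof induction
  case (refl \<Sigma>)
  then show ?case by (simp add: switching_equivalent.refl)
next
  case (step A B v)
  have "\<psi> v \<in> V"
    using step.hyps step.prems unfolding graph_automorphism_def by (blast dest: bij_betwE)
  then show ?case
    using step by (simp add: map_signature_resign resign_signature switching_equivalent.step)
qed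

lemma map_signature_comp:
  assumes "simple_graph V E" "graph_automorphism V E f" "\<Sigma> \<subseteq> E"
  shows "map_signature (g \<circ> f) \<Sigma> = map_signature g (map_signature f \<Sigma>)"
proof -
  have "map_signature g (map_signature f \<Sigma>) = (`) g ` map_signature f \<Sigma>"
    by (rule map_signature_image[OF assms(1) map_signature_subset[OF assms]])
  then show ?thesis
    unfolding map_signature_image[OF assms(1,3)] by (simp add: image_image)
qed

lemma equiv_switching_isomorphism:
  assumes "simple_graph V E"
  shows "equiv (signatures E) (switching_isomorphism V E)"
proof (rule equivI)
  show "switching_isomorphism V E \<subseteq> signatures E \<times> signatures E"
    by (auto simp: switching_isomorphism_def)
next
  show "refl_on (signatures E) (switching_isomorphism V E)"
  proof (rule refl_onI)
    fix A assume A: "A \<in> signatures E"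
    then have "map_signature id A = A"
      using map_signature_image[OF assms, of A id] by (simp add: signatures_def)
    then show "(A, A) \<in> switching_isomorphism V E"
      using A graph_automorphism_id switching_equivalent.refl
      by (force simp: switching_isomorphism_def switching_isomorphic_def)
  qed
next
  show "sym (switching_isomorphism V E)"
  proof (rule symI)
    fix A B assume "(A, B) \<in> switching_isomorphism V E"
    then obtain f where AB: "A \<subseteq> E" "B \<subseteq> E" and f: "graph_automorphism V E f"
      and s: "switching_equivalent V E (map_signature f A) B"
      by (auto simp: switching_isomorphism_def switching_isomorphic_def signatures_def)
    let ?g = "inv_into V f"
    have g: "graph_automorphism V E ?g" by (rule graph_automorphism_inv[OF f])
    have inj: "inj_on f V" using f unfolding graph_automorphism_def bij_betw_def by blast
    have "map_signature (?g \<circ> f) A = (\<lambda>e. e) ` A"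
      unfolding map_signature_image[OF assms AB(1)]
    proof (rule image_cong[OF HOL.refl])
      fix e assume "e \<in> A"
      then have "e \<subseteq> V" using AB assms by (auto simp: simple_graph_def)
      then show "(?g \<circ> f) ` e = e"
        using inj by (metis image_comp inv_into_image_cancel)
    qed
    then have "map_signature ?g (map_signature f A) = A"
      using map_signature_comp[OF assms f AB(1)] by simp
    moreover have "switching_equivalent V E (map_signature ?g (map_signature f A)) (map_signature ?g B)"
      using switching_equivalent_map_signature[OF s assms g map_signature_subset[OF assms f AB(1)]]
      by blast
    ultimately have "switching_equivalent V E (map_signature ?g B) A"
      by (metis switching_equivalent_sym)
    then show "(B, A) \<in> switching_isomorphism V E"
      using AB g by (auto simp: switching_isomorphism_def switching_isomorphic_def signatures_def)
  qed
next
  show "trans (switching_isomorphism V E)"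
  proof (rule transI)
    fix A B C
    assume "(A, B) \<in> switching_isomorphism V E" "(B, C) \<in> switching_isomorphism V E"
    then obtain f g where S: "A \<subseteq> E" "B \<subseteq> E" "C \<subseteq> E"
      and f: "graph_automorphism V E f" and g: "graph_automorphism V E g"
      and fA: "switching_equivalent V E (map_signature f A) B"
      and gB: "switching_equivalent V E (map_signature g B) C"
      by (auto simp: switching_isomorphism_def switching_isomorphic_def signatures_def)
    have "switching_equivalent V E (map_signature g (map_signature f A)) (map_signature g B)"
      using switching_equivalent_map_signature[OF fA assms g map_signature_subset[OF assms f S(1)]]
      by blast
    then have "switching_equivalent V E (map_signature (g \<circ> f) A) C"
      using switching_equivalent_trans[OF gB] map_signature_comp[OF assms f S(1)] by metis
    then show "(A, C) \<in> switching_isomorphism V E"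
      using S graph_automorphism_comp[OF f g]
      by (auto simp: switching_isomorphism_def switching_isomorphic_def signatures_def)
  qed
qed

datatype prism_vertex = U nat | V nat

definition P51_verts :: "prism_vertex set" where
  "P51_verts = U ` {0..<5} \<union> V ` {0..<5}"

definition P51_edges :: "prism_vertex set set" where
  "P51_edges =
     {{U i, U ((i + 1) mod 5)} |i. i < 5} \<union>
     {{V i, V ((i + 1) mod 5)} |i. i < 5} \<union>
     {{U i, V i} |i. i < 5}"

lemma simple_graph_P51: "simple_graph P51_verts P51_edges"
proof -
  have "(i + 1) mod 5 < 5 \<and> i \<noteq> (i + 1) mod 5" if "i < 5" for i :: nat
    using that by presburger
  then have "U i \<noteq> U ((i + 1) mod 5)" "V i \<noteq> V ((i + 1) mod 5)" "(i + 1) mod 5 < 5"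
    if "i < 5" for i :: nat
    using that by blast+
  then show ?thesis
    unfolding simple_graph_def P51_verts_def P51_edges_def by fastforce
qed

end

theory Submission
  imports Defs
begin

text \<open>
  Switching preserves the sign of every element of the cycle space, and automorphisms permute the
  elements of a given size; so the numbers of negative elements of sizes 4, 5 and 6 are invariants.
  In the prism these elements are the five squares, the two pentagons and the five sums of
  adjacent squares. Along a spanning tree every signature can be made positive, so the signs of the
  outer pentagon and of the five squares (the holonomy) determine it up to switching. Rotations turn
  the cyclic sign word of the squares into one of eight necklaces, and exchanging the two pentagons
  fixes this word while flipping the sign of the outer pentagon exactly when the word is odd. The
  four odd necklaces thus give one class each and the four even ones at most two each, and the three
  invariants separate the resulting twelve.
\<close>

section \<open>Negative elements of the cycle space\<close>

text \<open>For a graph with vertex set \<open>W\<close> this is the binary cycle space: its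
  elements are the edge-disjoint unions of cycles, the empty set included.\<close>

definition cycle_space :: "'a set \<Rightarrow> 'a set set \<Rightarrow> 'a set set set" where
  "cycle_space W E = {C. C \<subseteq> E \<and> (\<forall>v\<in>W. even (card {e \<in> C. v \<in> e}))}"

text \<open>The sign is the product of the edge signs. The definition is symmetric in its two
  arguments, so vertex parities can be expressed by it as well, a star taking either place.\<close>

definition negative :: "'b set \<Rightarrow> 'b set \<Rightarrow> bool" where
  "negative C \<Sigma> \<longleftrightarrow> odd (card (C \<inter> \<Sigma>))"

lemma odd_card_sym_diff:
  assumes "finite A" "finite B"
  shows "odd (card (sym_diff A B)) \<longleftrightarrow> odd (card A) \<noteq> odd (card B)"
proof -
  have "card A = card (A - B) + card (A \<inter> B)" "card B = card (B - A) + card (A \<inter> B)"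
    using assms by (metis card_Diff_subset_Int card_mono inf_le1 le_add_diff_inverse2 finite_Int,
      metis card_Diff_subset_Int card_mono inf_le1 le_add_diff_inverse2 finite_Int inf_commute)
  moreover have "card (sym_diff A B) = card (A - B) + card (B - A)"
    using assms by (intro card_Un_disjoint) auto
  ultimately show ?thesis by presburger
qed

text \<open>Signs are linear over GF(2): an edge common to \<open>A\<close> and \<open>B\<close> is
  counted twice and cancels.\<close>

lemma negative_sym_diff_left:
  assumes "finite A" "finite B"
  shows "negative (sym_diff A B) \<Sigma> \<longleftrightarrow> negative A \<Sigma> \<noteq> negative B \<Sigma>"
proof -
  have "sym_diff A B \<inter> \<Sigma> = sym_diff (A \<inter> \<Sigma>) (B \<inter> \<Sigma>)" by blast
  then show ?thesis
    using odd_card_sym_diff[of "A \<inter> \<Sigma>" "B \<inter> \<Sigma>"] assms by (simp add: negative_def)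
qed

lemma negative_empty [simp]: "\<not> negative {} \<Sigma>"
  by (simp add: negative_def)

text \<open>As a rewrite rule this evaluates the sign of an explicit edge set to an exclusive or of
  memberships; \<open>doubleton_eq_iff\<close> discharges the freshness conditions.\<close>

lemma negative_insert [simp]:
  assumes "finite A" "x \<notin> A"
  shows "negative (insert x A) \<Sigma> \<longleftrightarrow> (x \<in> \<Sigma>) \<noteq> negative A \<Sigma>"
  using assms by (simp add: negative_def Int_insert_left)

text \<open>Within \<open>C\<close>, resigning toggles exactly the edges at \<open>v\<close>, and
  there is an even number of them.\<close>

lemma negative_resign:
  assumes "finite E" "C \<in> cycle_space W E" "v \<in> W"
  shows "negative C (resign E v \<Sigma>) \<longleftrightarrow> negative C \<Sigma>"
proof -
  have "C \<subseteq> E" and even: "even (card {e \<in> C. v \<in> e})"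
    using assms by (auto simp: cycle_space_def)
  have fin: "finite C" by (rule finite_subset[OF \<open>C \<subseteq> E\<close> assms(1)])
  have "C \<inter> resign E v \<Sigma> = sym_diff (C \<inter> \<Sigma>) {e \<in> C. v \<in> e}"
    using \<open>C \<subseteq> E\<close> by (auto simp: resign_def)
  then show ?thesis
    using odd_card_sym_diff[of "C \<inter> \<Sigma>" "{e \<in> C. v \<in> e}"] fin even by (simp add: negative_def)
qed

lemma negative_switching_equivalent:
  assumes "switching_equivalent W E A B" "finite E" "C \<in> cycle_space W E"
  shows "negative C B \<longleftrightarrow> negative C A"
  using assms by induction (simp_all add: negative_resign)

lemma inj_on_image_edges:
  assumes "simple_graph W E" "graph_automorphism W E \<psi>"
  shows "inj_on ((`) \<psi>) E"
proof -
  have "inj_on \<psi> W"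
    using assms(2) unfolding graph_automorphism_def bij_betw_def by blast
  then show ?thesis
    using assms(1) by (intro inj_on_subset[OF inj_on_image_Pow]) (auto simp: simple_graph_def)
qed

text \<open>The induced map on edges is injective, so it carries the negative edges of
  \<open>C\<close> bijectively onto those of its image.\<close>

lemma negative_map_signature:
  assumes "simple_graph W E" "graph_automorphism W E \<psi>" "C \<subseteq> E" "\<Sigma> \<subseteq> E"
  shows "negative (map_signature \<psi> C) (map_signature \<psi> \<Sigma>) \<longleftrightarrow> negative C \<Sigma>"
proof -
  note inj = inj_on_image_edges[OF assms(1,2)]
  have "(`) \<psi> ` C \<inter> (`) \<psi> ` \<Sigma> = (`) \<psi> ` (C \<inter> \<Sigma>)"
    using assms(3,4) by (simp add: inj_on_image_Int[OF inj])
  moreover have "card ((`) \<psi> ` (C \<inter> \<Sigma>)) = card (C \<inter> \<Sigma>)"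
    using assms(3) by (intro card_image inj_on_subset[OF inj]) auto
  ultimately show ?thesis
    using assms by (simp add: negative_def map_signature_image)
qed

lemma card_map_signature:
  assumes "simple_graph W E" "graph_automorphism W E \<psi>" "C \<subseteq> E"
  shows "card (map_signature \<psi> C) = card C"
  unfolding map_signature_image[OF assms(1,3)]
  by (intro card_image inj_on_subset[OF inj_on_image_edges[OF assms(1,2)]] assms(3))

text \<open>Every vertex is some \<open>\<psi> v\<close>, and its star in the image is the bijective
  image of the star of \<open>v\<close> in \<open>C\<close>.\<close>

lemma map_signature_cycle_space:
  assumes "simple_graph W E" "graph_automorphism W E \<psi>" "C \<in> cycle_space W E"
  shows "map_signature \<psi> C \<in> cycle_space W E"
proof -
  have C: "C \<subseteq> E" "\<And>v. v \<in> W \<Longrightarrow> even (card {e \<in> C. v \<in> e})"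
    using assms(3) by (auto simp: cycle_space_def)
  have inj: "inj_on \<psi> W" and im: "\<psi> ` W = W"
    using assms(2) unfolding graph_automorphism_def bij_betw_def by blast+
  have "even (card {e \<in> map_signature \<psi> C. w \<in> e})" if "w \<in> W" for w
  proof -
    obtain v where v: "v \<in> W" "w = \<psi> v" using im \<open>w \<in> W\<close> by blast
    have "\<psi> v \<in> \<psi> ` e \<longleftrightarrow> v \<in> e" if "e \<in> C" for e
      using that C(1) assms(1) v(1)
      by (intro inj_on_image_mem_iff[OF inj]) (auto simp: simple_graph_def)
    then have "{e \<in> (`) \<psi> ` C. w \<in> e} = (`) \<psi> ` {e \<in> C. v \<in> e}"
      unfolding v(2) by blast
    moreover have "card ((`) \<psi> ` {e \<in> C. v \<in> e}) = card {e \<in> C. v \<in> e}"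
      using C(1) by (intro card_image inj_on_subset[OF inj_on_image_edges[OF assms(1,2)]]) auto
    ultimately show ?thesis
      using C(2)[OF v(1)] by (simp add: map_signature_image[OF assms(1) C(1)])
  qed
  then show ?thesis
    using map_signature_subset[OF assms(1,2) C(1)] by (simp add: cycle_space_def)
qed

section \<open>Numbers of negative elements of each size as invariants\<close>

definition negative_cycles :: "'a set \<Rightarrow> 'a set set \<Rightarrow> nat \<Rightarrow> 'a set set \<Rightarrow> 'a set set set" where
  "negative_cycles W E k \<Sigma> = {C \<in> cycle_space W E. card C = k \<and> negative C \<Sigma>}"

text \<open>The automorphism injects the negative elements of \<open>A\<close> into those of
  \<open>B\<close>: it preserves size and sign, and the subsequent switching preserves the sign.
  Sorting by size alone suits every automorphism, so the automorphism group never has to be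
  determined.\<close>

lemma card_negative_cycles_le:
  assumes "simple_graph W E" "finite E" "(A, B) \<in> switching_isomorphism W E"
  shows "card (negative_cycles W E k A) \<le> card (negative_cycles W E k B)"
proof -
  obtain \<psi> where A: "A \<subseteq> E" and \<psi>: "graph_automorphism W E \<psi>"
    and sw: "switching_equivalent W E (map_signature \<psi> A) B"
    using assms(3)
    by (auto simp: switching_isomorphism_def switching_isomorphic_def signatures_def)
  have sub: "C \<subseteq> E" if "C \<in> negative_cycles W E k \<Sigma>" for C \<Sigma>
    using that by (simp add: negative_cycles_def cycle_space_def)
  have "map_signature \<psi> ` negative_cycles W E k A \<subseteq> negative_cycles W E k B"
  proof (intro image_subsetI)
    fix C assume C: "C \<in> negative_cycles W E k A"
    then have cyc: "map_signature \<psi> C \<in> cycle_space W E"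
      using map_signature_cycle_space[OF assms(1) \<psi>] by (simp add: negative_cycles_def)
    then have "negative (map_signature \<psi> C) B"
      using C negative_switching_equivalent[OF sw assms(2) cyc]
        negative_map_signature[OF assms(1) \<psi> sub[OF C] A]
      by (simp add: negative_cycles_def)
    then show "map_signature \<psi> C \<in> negative_cycles W E k B"
      using C cyc card_map_signature[OF assms(1) \<psi> sub[OF C]] by (simp add: negative_cycles_def)
  qed
  moreover have "inj_on (map_signature \<psi>) (negative_cycles W E k A)"
  proof (rule inj_onI)
    fix C D assume CD: "C \<in> negative_cycles W E k A" "D \<in> negative_cycles W E k A"
      and "map_signature \<psi> C = map_signature \<psi> D"
    then have "(`) \<psi> ` C = (`) \<psi> ` D"
      unfolding map_signature_image[OF assms(1) sub[OF CD(1)]]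
        map_signature_image[OF assms(1) sub[OF CD(2)]]
      by blast
    then show "C = D"
      using inj_on_image_eq_iff[OF inj_on_image_edges[OF assms(1) \<psi>] sub[OF CD(1)] sub[OF CD(2)]]
      by blast
  qed
  moreover have "finite (negative_cycles W E k B)"
    by (rule finite_subset[of _ "Pow E"]) (use sub assms(2) in blast)+
  ultimately show ?thesis by (meson card_inj_on_le)
qed

lemma card_negative_cycles_eq:
  assumes "simple_graph W E" "finite E" "(A, B) \<in> switching_isomorphism W E"
  shows "card (negative_cycles W E k A) = card (negative_cycles W E k B)"
proof (rule antisym)
  have "(B, A) \<in> switching_isomorphism W E"
    using equiv_switching_isomorphism[OF assms(1)] assms(3) by (meson equivE symD)
  then show "card (negative_cycles W E k B) \<le> card (negative_cycles W E k A)"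
    by (rule card_negative_cycles_le[OF assms(1,2)])
qed (rule card_negative_cycles_le[OF assms])

text \<open>
  Listing a forest from the leaves inwards, each edge paired with an endpoint that lies on no later
  edge, one can make all its edges positive: resigning at that endpoint leaves the later edges alone.
\<close>

lemma switching_equivalent_forest:
  assumes "\<forall>(v, e)\<in>set xs. v \<in> W \<and> e \<in> E \<and> v \<in> e"
    and "sorted_wrt (\<lambda>(v, e) (w, d). v \<notin> d) xs"
  shows "\<exists>\<Sigma>'. switching_equivalent W E \<Sigma> \<Sigma>' \<and> \<Sigma>' \<inter> snd ` set xs = {}"
  using assms
proof (induction xs)
  case Nil
  show ?case by (auto intro: switching_equivalent.refl)
next
  case (Cons x xs)
  obtain v e where x: "x = (v, e)" by fastforce
  obtain \<Sigma>' where \<Sigma>': "switching_equivalent W E \<Sigma> \<Sigma>'" "\<Sigma>' \<inter> snd ` set xs = {}"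
    using Cons by auto
  show ?case
  proof (cases "e \<in> \<Sigma>'")
    case True
    have "switching_equivalent W E \<Sigma> (resign E v \<Sigma>')"
      using \<Sigma>'(1) Cons.prems(1) x by (auto intro: switching_equivalent.step)
    moreover have "resign E v \<Sigma>' \<inter> snd ` set (x # xs) = {}"
    proof -
      have "v \<in> e" "e \<in> E" and "v \<notin> d" if "d \<in> snd ` set xs" for d
        using Cons.prems x that by auto
      then show ?thesis using True \<Sigma>'(2) Cons.prems(1) x by (auto simp: resign_def)
    qed
    ultimately show ?thesis by blast
  next
    case False
    then show ?thesis using \<Sigma>' x by auto
  qed
qed

lemma switching_equivalent_subset:
  assumes "switching_equivalent W E A B" "A \<subseteq> E"
  shows "B \<subseteq> E"
  using assms by induction (simp_all add: resign_signature)

lemma sym_diff_cycle_space: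
  assumes "finite E" "C \<in> cycle_space W E" "D \<in> cycle_space W E"
  shows "sym_diff C D \<in> cycle_space W E"
proof -
  have CD: "C \<subseteq> E" "D \<subseteq> E" and fin: "finite C" "finite D"
    using assms by (auto simp: cycle_space_def intro: finite_subset)
  have "even (card {e \<in> sym_diff C D. v \<in> e})" if "v \<in> W" for v
  proof -
    have "{e \<in> sym_diff C D. v \<in> e} = sym_diff {e \<in> C. v \<in> e} {e \<in> D. v \<in> e}" by blast
    then show ?thesis
      using odd_card_sym_diff[of "{e \<in> C. v \<in> e}" "{e \<in> D. v \<in> e}"] fin that assms(2,3)
      by (simp add: cycle_space_def)
  qed
  then show ?thesis using CD by (auto simp: cycle_space_def)
qed

section \<open>Short cycles of the pentagonal prism\<close>

text \<open>Keeps the index \<open>1\<close> from turning into \<open>Suc 0\<close>, so that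
  vertices such as \<open>U 1\<close> keep one syntactic form.\<close>

declare One_nat_def [simp del]

lemma lessThan_5: "{..<5} = {0, 1, 2, 3, 4 :: nat}"
proof (rule set_eqI)
  show "x \<in> {..<5} \<longleftrightarrow> x \<in> {0, 1, 2, 3, 4 :: nat}" for x
    unfolding lessThan_iff insert_iff empty_iff by arith
qed

text \<open>The order fixes coordinates: five outer edges, five inner edges, five spokes, each block
  in cyclic order.\<close>

definition edge_list :: "prism_vertex set list" where
  "edge_list =
     [{U 0, U 1}, {U 1, U 2}, {U 2, U 3}, {U 3, U 4}, {U 4, U 0},
      {V 0, V 1}, {V 1, V 2}, {V 2, V 3}, {V 3, V 4}, {V 4, V 0},
      {U 0, V 0}, {U 1, V 1}, {U 2, V 2}, {U 3, V 3}, {U 4, V 4}]"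

lemma P51_edges_eq: "P51_edges = set edge_list"
proof -
  have *: "{f i |i. i < 5} = {f 0, f 1, f 2, f 3, f 4}" for f :: "nat \<Rightarrow> prism_vertex set"
  proof -
    have "i < 5 \<longleftrightarrow> i = 0 \<or> i = 1 \<or> i = 2 \<or> i = 3 \<or> i = 4" for i :: nat by arith
    then show ?thesis by (simp only:) blast
  qed
  have **: "P51_edges = {{U 0, U ((0 + 1) mod 5)}, {U 1, U ((1 + 1) mod 5)}, {U 2, U ((2 + 1) mod 5)},
        {U 3, U ((3 + 1) mod 5)}, {U 4, U ((4 + 1) mod 5)}} \<union>
      {{V 0, V ((0 + 1) mod 5)}, {V 1, V ((1 + 1) mod 5)}, {V 2, V ((2 + 1) mod 5)},
        {V 3, V ((3 + 1) mod 5)}, {V 4, V ((4 + 1) mod 5)}} \<union>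
      {{U 0, V 0}, {U 1, V 1}, {U 2, V 2}, {U 3, V 3}, {U 4, V 4}}"
    unfolding P51_edges_def * ..
  show ?thesis unfolding ** edge_list_def by (simp del: Un_insert_right)
qed

lemma P51_verts_eq: "P51_verts = {U 0, U 1, U 2, U 3, U 4, V 0, V 1, V 2, V 3, V 4}"
  unfolding P51_verts_def atLeast0LessThan lessThan_5 by (simp add: insert_commute)

lemma finite_P51_edges: "finite P51_edges"
  by (simp add: P51_edges_eq)

text \<open>The characteristic vector in the coordinates of \<open>edge_list\<close>. Equality and
  size of subsets of \<open>P51_edges\<close> become computations with fifteen Booleans.\<close>

definition bits :: "prism_vertex set set \<Rightarrow> bool list" where
  "bits C = map (\<lambda>e. e \<in> C) edge_list"

lemma bits_inject:
  assumes "C \<subseteq> P51_edges" "D \<subseteq> P51_edges"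
  shows "bits C = bits D \<longleftrightarrow> C = D"
proof -
  have "bits C = bits D \<longleftrightarrow> (\<forall>e\<in>P51_edges. e \<in> C \<longleftrightarrow> e \<in> D)"
    unfolding bits_def P51_edges_eq by (rule map_eq_conv)
  then show ?thesis using assms by blast
qed

lemma distinct_edge_list: "distinct edge_list"
  by (simp add: edge_list_def doubleton_eq_iff)

lemma card_eq_bits:
  assumes "C \<subseteq> P51_edges"
  shows "card C = length (filter id (bits C))"
proof -
  have "C = set (filter (\<lambda>e. e \<in> C) edge_list)" using assms by (auto simp: P51_edges_eq)
  then have "card C = length (filter (\<lambda>e. e \<in> C) edge_list)"
    using distinct_card[OF distinct_filter[OF distinct_edge_list]] by metis
  then show ?thesis by (simp add: bits_def filter_map comp_def)
qed

definition pentagon :: "(nat \<Rightarrow> prism_vertex) \<Rightarrow> prism_vertex set set" where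
  "pentagon X = {{X 0, X 1}, {X 1, X 2}, {X 2, X 3}, {X 3, X 4}, {X 4, X 0}}"

definition square :: "nat \<Rightarrow> prism_vertex set set" where
  "square i = {{U i, U ((i + 1) mod 5)}, {V i, V ((i + 1) mod 5)},
     {U i, V i}, {U ((i + 1) mod 5), V ((i + 1) mod 5)}}"

text \<open>The common spoke of the two adjacent squares cancels and six edges remain. Written as a
  sum, it inherits membership in the cycle space and its sign from the squares.\<close>

definition hexagon :: "nat \<Rightarrow> prism_vertex set set" where
  "hexagon i = sym_diff (square i) (square ((i + 1) mod 5))"

lemma all_less_5:
  fixes P :: "nat \<Rightarrow> bool"
  shows "(\<forall>i<5. P i) \<longleftrightarrow> P 0 \<and> P 1 \<and> P 2 \<and> P 3 \<and> P 4"
proof -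
  have "(\<forall>i<5. P i) \<longleftrightarrow> (\<forall>i\<in>{..<5}. P i)" by auto
  then show ?thesis by (simp add: lessThan_5)
qed

lemma cycles_subset:
  "pentagon U \<subseteq> P51_edges" "pentagon V \<subseteq> P51_edges"
  "i < 5 \<Longrightarrow> square i \<subseteq> P51_edges" "i < 5 \<Longrightarrow> hexagon i \<subseteq> P51_edges"
proof -
  show "pentagon U \<subseteq> P51_edges" "pentagon V \<subseteq> P51_edges"
    by (simp_all add: pentagon_def P51_edges_eq edge_list_def)
  have sq: "\<forall>i<5. square i \<subseteq> P51_edges"
    unfolding all_less_5 by (simp add: square_def P51_edges_eq edge_list_def insert_commute)
  then show "i < 5 \<Longrightarrow> square i \<subseteq> P51_edges" by blast
  show "hexagon i \<subseteq> P51_edges" if "i < 5"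
  proof -
    have "square i \<subseteq> P51_edges" "square ((i + 1) mod 5) \<subseteq> P51_edges" using sq that by simp_all
    then show ?thesis unfolding hexagon_def by blast
  qed
qed

lemma bits_pentagon:
  "bits (pentagon U) = [True, True, True, True, True, False, False, False, False, False,
     False, False, False, False, False]"
  "bits (pentagon V) = [False, False, False, False, False, True, True, True, True, True,
     False, False, False, False, False]"
  by (simp_all add: bits_def edge_list_def pentagon_def doubleton_eq_iff)

lemma bits_square:
  "bits (square 0) = [True, False, False, False, False, True, False, False, False, False,
     True, True, False, False, False]"
  "bits (square 1) = [False, True, False, False, False, False, True, False, False, False,
     False, True, True, False, False]"
  "bits (square 2) = [False, False, True, False, False, False, False, True, False, False,
     False, False, True, True, False]"
  "bits (square 3) = [False, False, False, True, False, False, False, False, True, False,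
     False, False, False, True, True]"
  "bits (square 4) = [False, False, False, False, True, False, False, False, False, True,
     True, False, False, False, True]"
  by (simp_all add: bits_def edge_list_def square_def doubleton_eq_iff)

lemma bits_sym_diff: "bits (sym_diff C D) = map2 (\<noteq>) (bits C) (bits D)"
proof -
  have "map (\<lambda>e. e \<in> sym_diff C D) es = map2 (\<noteq>) (map (\<lambda>e. e \<in> C) es) (map (\<lambda>e. e \<in> D) es)" for es
    by (induction es) auto
  then show ?thesis by (simp only: bits_def)
qed

lemma bits_hexagon:
  "bits (hexagon 0) = [True, True, False, False, False, True, True, False, False, False,
     True, False, True, False, False]"
  "bits (hexagon 1) = [False, True, True, False, False, False, True, True, False, False,
     False, True, False, True, False]"
  "bits (hexagon 2) = [False, False, True, True, False, False, False, True, True, False,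
     False, False, True, False, True]"
  "bits (hexagon 3) = [False, False, False, True, True, False, False, False, True, True,
     True, False, False, True, False]"
  "bits (hexagon 4) = [True, False, False, False, True, True, False, False, False, True,
     False, True, False, False, True]"
  by (simp_all add: hexagon_def bits_sym_diff bits_square)

text \<open>The star plays the signature here, so that \<open>negative_insert\<close> can evaluate
  vertex parities of an explicit \<open>C\<close>.\<close>

lemma even_star_iff: "even (card {e \<in> C. v \<in> e}) \<longleftrightarrow> \<not> negative C {e. v \<in> e}"
  by (simp add: negative_def Int_def)

lemma cycles_in_cycle_space:
  "pentagon U \<in> cycle_space P51_verts P51_edges" "pentagon V \<in> cycle_space P51_verts P51_edges"
  "i < 5 \<Longrightarrow> square i \<in> cycle_space P51_verts P51_edges"
  "i < 5 \<Longrightarrow> hexagon i \<in> cycle_space P51_verts P51_edges"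
proof -
  show "pentagon U \<in> cycle_space P51_verts P51_edges" "pentagon V \<in> cycle_space P51_verts P51_edges"
    using cycles_subset(1,2)
    by (simp_all add: cycle_space_def even_star_iff P51_verts_eq pentagon_def doubleton_eq_iff)
  have "\<forall>i<5. \<forall>v\<in>P51_verts. \<not> negative (square i) {e. v \<in> e}"
    unfolding all_less_5 by (simp add: P51_verts_eq square_def doubleton_eq_iff)
  then have sq: "square i \<in> cycle_space P51_verts P51_edges" if "i < 5" for i
    using cycles_subset(3) that by (simp add: cycle_space_def even_star_iff)
  show "i < 5 \<Longrightarrow> square i \<in> cycle_space P51_verts P51_edges" by (rule sq)
  show "i < 5 \<Longrightarrow> hexagon i \<in> cycle_space P51_verts P51_edges"
    unfolding hexagon_def by (intro sym_diff_cycle_space finite_P51_edges sq) simp_all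
qed

section \<open>Classification of the cycle space elements of sizes 4, 5 and 6\<close>

lemma star_P51:
  assumes "C \<in> cycle_space P51_verts P51_edges" "v \<in> P51_verts"
  shows "\<not> negative (set (filter (\<lambda>e. v \<in> e) edge_list)) C"
proof -
  have "C \<subseteq> P51_edges" "even (card {e \<in> C. v \<in> e})"
    using assms by (auto simp: cycle_space_def)
  \<comment> \<open>Now the star is the explicit set and \<open>C\<close> takes the place of the
    signature; evaluating the star yields equations between the unknown bits of
    \<open>C\<close>.\<close>
  moreover from this(1) have "{e \<in> C. v \<in> e} = set (filter (\<lambda>e. v \<in> e) edge_list) \<inter> C"
    by (auto simp: P51_edges_eq)
  ultimately show ?thesis by (simp add: negative_def)
qed

text \<open>Each vertex lies on two pentagon edges and one spoke, so evenness there makes the spoke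
  bit the exclusive or of the other two. The letters \<open>a\<close>, \<open>b\<close>,
  \<open>c\<close> stand for outer edges, inner edges and spokes.\<close>

lemma cycle_space_parity:
  assumes "C \<in> cycle_space P51_verts P51_edges"
    and bits: "bits C = [a0, a1, a2, a3, a4, b0, b1, b2, b3, b4, c0, c1, c2, c3, c4]"
  shows "c0 \<longleftrightarrow> a4 \<noteq> a0" "c1 \<longleftrightarrow> a0 \<noteq> a1" "c2 \<longleftrightarrow> a1 \<noteq> a2" "c3 \<longleftrightarrow> a2 \<noteq> a3" "c4 \<longleftrightarrow> a3 \<noteq> a4"
    "c0 \<longleftrightarrow> b4 \<noteq> b0" "c1 \<longleftrightarrow> b0 \<noteq> b1" "c2 \<longleftrightarrow> b1 \<noteq> b2" "c3 \<longleftrightarrow> b2 \<noteq> b3" "c4 \<longleftrightarrow> b3 \<noteq> b4"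
proof -
  have star: "\<not> negative (set (filter (\<lambda>e. v \<in> e) edge_list)) C" if "v \<in> P51_verts" for v
    by (rule star_P51[OF assms(1) that])
  note mem = bits[unfolded bits_def edge_list_def list.map list.inject]
  show "c0 \<longleftrightarrow> a4 \<noteq> a0"
    using star[of "U 0"] mem
    by (simp add: P51_verts_eq edge_list_def doubleton_eq_iff; blast)
  show "c1 \<longleftrightarrow> a0 \<noteq> a1"
    using star[of "U 1"] mem
    by (simp add: P51_verts_eq edge_list_def doubleton_eq_iff; blast)
  show "c2 \<longleftrightarrow> a1 \<noteq> a2"
    using star[of "U 2"] mem
    by (simp add: P51_verts_eq edge_list_def doubleton_eq_iff; blast)
  show "c3 \<longleftrightarrow> a2 \<noteq> a3"
    using star[of "U 3"] mem
    by (simp add: P51_verts_eq edge_list_def doubleton_eq_iff; blast)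
  show "c4 \<longleftrightarrow> a3 \<noteq> a4"
    using star[of "U 4"] mem
    by (simp add: P51_verts_eq edge_list_def doubleton_eq_iff; blast)
  show "c0 \<longleftrightarrow> b4 \<noteq> b0"
    using star[of "V 0"] mem
    by (simp add: P51_verts_eq edge_list_def doubleton_eq_iff; blast)
  show "c1 \<longleftrightarrow> b0 \<noteq> b1"
    using star[of "V 1"] mem
    by (simp add: P51_verts_eq edge_list_def doubleton_eq_iff; blast)
  show "c2 \<longleftrightarrow> b1 \<noteq> b2"
    using star[of "V 2"] mem
    by (simp add: P51_verts_eq edge_list_def doubleton_eq_iff; blast)
  show "c3 \<longleftrightarrow> b2 \<noteq> b3"
    using star[of "V 3"] mem
    by (simp add: P51_verts_eq edge_list_def doubleton_eq_iff; blast)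
  show "c4 \<longleftrightarrow> b3 \<noteq> b4"
    using star[of "V 4"] mem
    by (simp add: P51_verts_eq edge_list_def doubleton_eq_iff; blast)
qed

definition squares :: "prism_vertex set set list" where
  "squares = [square 0, square 1, square 2, square 3, square 4]"

definition hexagons :: "prism_vertex set set list" where
  "hexagons = [hexagon 0, hexagon 1, hexagon 2, hexagon 3, hexagon 4]"

text \<open>The parity equations leave \<open>a0\<close> to \<open>a4\<close> and \<open>b0\<close>
  free, in accordance with the dimension 15 - 10 + 1 = 6 of the cycle space. All 64 elements are
  inspected.\<close>

lemma bits_short_cycle:
  assumes "C \<in> cycle_space P51_verts P51_edges"
  shows "card C = 4 \<Longrightarrow> bits C \<in> bits ` set squares"
    and "card C = 5 \<Longrightarrow> bits C \<in> bits ` {pentagon U, pentagon V}"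
    and "card C = 6 \<Longrightarrow> bits C \<in> bits ` set hexagons"
proof -
  obtain a0 a1 a2 a3 a4 b0 b1 b2 b3 b4 c0 c1 c2 c3 c4
    where bits: "bits C = [a0, a1, a2, a3, a4, b0, b1, b2, b3, b4, c0, c1, c2, c3, c4]"
    by (simp add: bits_def edge_list_def)
  note parity = cycle_space_parity[OF assms bits]
  have sub: "C \<subseteq> P51_edges" using assms by (simp add: cycle_space_def)
  \<comment> \<open>Each spoke bit has an outer and an inner expression; equating them determines
    the inner bits successively from \<open>b0\<close>.\<close>
  have b: "b1 \<longleftrightarrow> b0 \<noteq> (a0 \<noteq> a1)" "b2 \<longleftrightarrow> b1 \<noteq> (a1 \<noteq> a2)" "b3 \<longleftrightarrow> b2 \<noteq> (a2 \<noteq> a3)" "b4 \<longleftrightarrow> b3 \<noteq> (a3 \<noteq> a4)"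
    using parity by blast+
  show "bits C \<in> bits ` set squares" if "card C = 4"
    using that unfolding card_eq_bits[OF sub] bits parity(1-5) b squares_def
    by (cases a0; cases a1; cases a2; cases a3; cases a4; cases b0; simp add: bits_square)
  show "bits C \<in> bits ` {pentagon U, pentagon V}" if "card C = 5"
    using that unfolding card_eq_bits[OF sub] bits parity(1-5) b
    by (cases a0; cases a1; cases a2; cases a3; cases a4; cases b0; simp add: bits_pentagon)
  show "bits C \<in> bits ` set hexagons" if "card C = 6"
    using that unfolding card_eq_bits[OF sub] bits parity(1-5) b hexagons_def
    by (cases a0; cases a1; cases a2; cases a3; cases a4; cases b0; simp add: bits_hexagon)
qed

lemma short_cycles:
  "{C \<in> cycle_space P51_verts P51_edges. card C = 4} = set squares" (is "?A = _")
  "{C \<in> cycle_space P51_verts P51_edges. card C = 5} = {pentagon U, pentagon V}" (is "?B = _")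
  "{C \<in> cycle_space P51_verts P51_edges. card C = 6} = set hexagons" (is "?C = _")
proof -
  have sub: "C \<subseteq> P51_edges" if "C \<in> cycle_space P51_verts P51_edges" for C
    using that by (simp add: cycle_space_def)
  \<comment> \<open>Since \<open>bits\<close> is injective on subsets of \<open>P51_edges\<close>,
    the harder inclusion may be checked on bit vectors.\<close>
  have eq: "X = Y" if "X \<subseteq> cycle_space P51_verts P51_edges" "Y \<subseteq> X" "bits ` X \<subseteq> bits ` Y" for X Y
  proof
    show "X \<subseteq> Y"
    proof
      fix C assume "C \<in> X"
      then obtain D where "D \<in> Y" "bits C = bits D" using \<open>bits ` X \<subseteq> bits ` Y\<close> by blast
      then show "C \<in> Y" using bits_inject[of C D] sub \<open>C \<in> X\<close> that(1,2) by blast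
    qed
  qed (rule that(2))
  show "?A = set squares"
    using bits_short_cycle(1) cycles_in_cycle_space(3)
    by (intro eq) (auto simp: squares_def card_eq_bits cycles_subset bits_square)
  show "?B = {pentagon U, pentagon V}"
    using bits_short_cycle(2) cycles_in_cycle_space(1,2)
    by (intro eq) (auto simp: card_eq_bits cycles_subset bits_pentagon)
  show "?C = set hexagons"
    using bits_short_cycle(3) cycles_in_cycle_space(4)
    by (intro eq) (auto simp: hexagons_def card_eq_bits cycles_subset bits_hexagon)
qed

section \<open>Holonomies\<close>

text \<open>The six signs are taken on a basis of the cycle space. The squares are listed in cyclic
  order, so that rotations of the prism act by rotating the word.\<close>

definition holonomy :: "prism_vertex set set \<Rightarrow> bool \<times> bool list" where
  "holonomy \<Sigma> = (negative (pentagon U) \<Sigma>, map (\<lambda>C. negative C \<Sigma>) squares)"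

text \<open>The exclusive or of all entries, true exactly for words with an odd number of
  \<open>True\<close>.\<close>

definition parity :: "bool list \<Rightarrow> bool" where
  "parity q = foldr (\<noteq>) q False"

text \<open>In the sum of the outer pentagon and all five squares every spoke and every outer edge
  occurs twice, so only the inner pentagon survives; linearity of signs does the rest.\<close>

lemma negative_inner_pentagon:
  "negative (pentagon V) \<Sigma> \<longleftrightarrow> fst (holonomy \<Sigma>) \<noteq> parity (snd (holonomy \<Sigma>))"
proof -
  let ?D = "sym_diff (pentagon U) (sym_diff (square 0) (sym_diff (square 1)
    (sym_diff (square 2) (sym_diff (square 3) (square 4)))))"
  have fin: "finite (pentagon U)" "finite (square i)" for i
    by (simp_all add: pentagon_def square_def)
  have "?D \<subseteq> P51_edges"
    using cycles_subset(1) cycles_subset(3)[of 0] cycles_subset(3)[of 1] cycles_subset(3)[of 2]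
      cycles_subset(3)[of 3] cycles_subset(3)[of 4] by auto
  moreover have "bits (pentagon V) = bits ?D"
    by (simp add: bits_sym_diff bits_square bits_pentagon)
  ultimately have "pentagon V = ?D"
    using bits_inject[OF cycles_subset(2)] by blast
  then have "negative (pentagon V) \<Sigma> \<longleftrightarrow> negative ?D \<Sigma>" by (rule arg_cong)
  also have "\<dots> \<longleftrightarrow> fst (holonomy \<Sigma>) \<noteq> parity (snd (holonomy \<Sigma>))"
    by (simp only: negative_sym_diff_left fin finite_Un finite_Diff)
      (simp add: holonomy_def parity_def squares_def)
  finally show ?thesis .
qed

text \<open>The components count negative squares, pentagons and hexagons. The inner pentagon has
  sign \<open>p \<noteq> parity q\<close>, and \<open>rotate1\<close> aligns each square with its
  successor, whose sum with it is a hexagon.\<close>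

definition spectrum :: "bool \<times> bool list \<Rightarrow> nat \<times> nat \<times> nat" where
  "spectrum = (\<lambda>(p, q). (length (filter id q), length (filter id [p, p \<noteq> parity q]),
     length (filter id (map2 (\<noteq>) q (rotate1 q)))))"

lemma card_negative_cycles:
  assumes "{C \<in> cycle_space W E. card C = k} = set Cs" "distinct Cs"
  shows "card (negative_cycles W E k \<Sigma>) = length (filter id (map (\<lambda>C. negative C \<Sigma>) Cs))"
proof -
  have "negative_cycles W E k \<Sigma> = set (filter (\<lambda>C. negative C \<Sigma>) Cs)"
    using assms(1) unfolding negative_cycles_def by auto
  then show ?thesis
    using distinct_card[OF distinct_filter[OF assms(2)]] by (simp add: filter_map comp_def)
qed

lemma distinct_bits: "distinct (map bits Cs) \<Longrightarrow> distinct Cs"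
  by (simp add: distinct_map)

lemma distinct_squares: "distinct squares"
  by (rule distinct_bits) (simp add: squares_def bits_square)

lemma distinct_hexagons: "distinct hexagons"
  by (rule distinct_bits) (simp add: hexagons_def bits_hexagon)

text \<open>By the classification of short elements, the triple computed from the holonomy consists
  of the three invariant counts.\<close>

lemma spectrum_holonomy:
  "spectrum (holonomy \<Sigma>) =
     (card (negative_cycles P51_verts P51_edges 4 \<Sigma>),
      card (negative_cycles P51_verts P51_edges 5 \<Sigma>),
      card (negative_cycles P51_verts P51_edges 6 \<Sigma>))"
proof -
  have fin: "finite (square i)" for i by (simp add: square_def)
  have "distinct [pentagon U, pentagon V]"
    by (rule distinct_bits) (simp add: bits_pentagon)
  moreover have "{C \<in> cycle_space P51_verts P51_edges. card C = 5} = set [pentagon U, pentagon V]"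
    using short_cycles(2) by simp
  ultimately have "card (negative_cycles P51_verts P51_edges 5 \<Sigma>)
      = length (filter id (map (\<lambda>C. negative C \<Sigma>) [pentagon U, pentagon V]))"
    by (intro card_negative_cycles)
  moreover have "negative (pentagon U) \<Sigma> \<longleftrightarrow> fst (holonomy \<Sigma>)"
    by (simp add: holonomy_def)
  ultimately have 5: "card (negative_cycles P51_verts P51_edges 5 \<Sigma>)
      = length (filter id [fst (holonomy \<Sigma>), fst (holonomy \<Sigma>) \<noteq> parity (snd (holonomy \<Sigma>))])"
    by (simp only: list.map negative_inner_pentagon)
  have 4: "map (\<lambda>C. negative C \<Sigma>) squares = snd (holonomy \<Sigma>)"
    by (simp add: holonomy_def)
  have 6: "map (\<lambda>C. negative C \<Sigma>) hexagons
      = map2 (\<noteq>) (snd (holonomy \<Sigma>)) (rotate1 (snd (holonomy \<Sigma>)))"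
    by (simp add: hexagons_def holonomy_def squares_def hexagon_def negative_sym_diff_left fin)
  show ?thesis
    unfolding 5 card_negative_cycles[OF short_cycles(1) distinct_squares]
      card_negative_cycles[OF short_cycles(3) distinct_hexagons] 4 6
    by (simp only: spectrum_def case_prod_beta)
qed

lemma spectrum_switching_isomorphism:
  assumes "(A, B) \<in> switching_isomorphism P51_verts P51_edges"
  shows "spectrum (holonomy A) = spectrum (holonomy B)"
  unfolding spectrum_holonomy
  using card_negative_cycles_eq[OF simple_graph_P51 finite_P51_edges assms] by simp

section \<open>Normal form along a spanning tree\<close>

definition tree :: "(prism_vertex \<times> prism_vertex set) list" where
  "tree =
     [(V 0, {U 0, V 0}), (V 1, {U 1, V 1}), (V 2, {U 2, V 2}), (V 3, {U 3, V 3}), (V 4, {U 4, V 4}),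
      (U 4, {U 3, U 4}), (U 3, {U 2, U 3}), (U 2, {U 1, U 2}), (U 1, {U 0, U 1})]"

text \<open>The list \<open>tree\<close> is ordered from the leaves inwards: first the spokes, each
  with its inner endpoint, then the outer path from \<open>U 4\<close> back to \<open>U 0\<close>,
  each edge with its endpoint farther from \<open>U 0\<close>.\<close>

lemma switching_equivalent_tree:
  "\<exists>\<Sigma>'. switching_equivalent P51_verts P51_edges \<Sigma> \<Sigma>' \<and> \<Sigma>' \<inter> snd ` set tree = {}"
  by (rule switching_equivalent_forest)
    (simp_all add: tree_def P51_verts_eq P51_edges_eq edge_list_def)

lemma holonomy_switching_equivalent:
  assumes "switching_equivalent P51_verts P51_edges A B"
  shows "holonomy B = holonomy A"
proof -
  have "negative C B \<longleftrightarrow> negative C A" if "C \<in> cycle_space P51_verts P51_edges" for C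
    by (rule negative_switching_equivalent[OF assms finite_P51_edges that])
  then show ?thesis
    by (simp add: holonomy_def squares_def cycles_in_cycle_space)
qed

text \<open>Six edges lie outside the tree. The outer pentagon reads off \<open>{U 4, U 0}\<close>,
  squares 0 to 3 read off one inner edge each, and square 4 then yields
  \<open>{V 4, V 0}\<close>.\<close>

lemma holonomy_inject_tree:
  assumes "A \<subseteq> P51_edges" "A \<inter> snd ` set tree = {}" "B \<subseteq> P51_edges" "B \<inter> snd ` set tree = {}"
    and "holonomy A = holonomy B"
  shows "A = B"
proof -
  have "bits A = bits B"
    using assms(2,4,5)
    by (simp add: bits_def edge_list_def holonomy_def squares_def square_def pentagon_def tree_def
        doubleton_eq_iff insert_commute) blast
  then show ?thesis using bits_inject assms(1,3) by blast
qed

text \<open>Switching both signatures to be positive on the tree keeps their holonomies, so the two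
  normal forms coincide.\<close>

lemma switching_equivalent_if_holonomy_eq:
  assumes "A \<subseteq> P51_edges" "B \<subseteq> P51_edges" "holonomy A = holonomy B"
  shows "switching_equivalent P51_verts P51_edges A B"
proof -
  obtain A' B' where A': "switching_equivalent P51_verts P51_edges A A'" "A' \<inter> snd ` set tree = {}"
    and B': "switching_equivalent P51_verts P51_edges B B'" "B' \<inter> snd ` set tree = {}"
    using switching_equivalent_tree by meson
  have "holonomy A' = holonomy B'"
    using holonomy_switching_equivalent A'(1) B'(1) assms(3) by metis
  then have "A' = B'"
    using holonomy_inject_tree switching_equivalent_subset A' B' assms(1,2) by metis
  then show ?thesis
    using A'(1) switching_equivalent_sym[OF B'(1)] switching_equivalent_trans by metis
qed

lemma holonomy_surj: "\<exists>\<Sigma>\<subseteq>P51_edges. holonomy \<Sigma> = (p, [q0, q1, q2, q3, q4])"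
proof (intro exI conjI)
  \<comment> \<open>Only edges outside the tree are used. Square 4 also contains
    \<open>{U 4, U 0}\<close>, whence the correction of \<open>q4\<close> by
    \<open>p\<close>.\<close>
  define \<Sigma> where "\<Sigma> = {e \<in> P51_edges. e = {U 4, U 0} \<and> p \<or> e = {V 0, V 1} \<and> q0 \<or> e = {V 1, V 2} \<and> q1 \<or>
    e = {V 2, V 3} \<and> q2 \<or> e = {V 3, V 4} \<and> q3 \<or> e = {V 4, V 0} \<and> q4 \<noteq> p}"
  show "\<Sigma> \<subseteq> P51_edges" unfolding \<Sigma>_def by blast
  have mem: "{U 4, U 0} \<in> \<Sigma> \<longleftrightarrow> p" "{V 0, V 1} \<in> \<Sigma> \<longleftrightarrow> q0" "{V 1, V 2} \<in> \<Sigma> \<longleftrightarrow> q1"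
    "{V 2, V 3} \<in> \<Sigma> \<longleftrightarrow> q2" "{V 3, V 4} \<in> \<Sigma> \<longleftrightarrow> q3" "{V 4, V 0} \<in> \<Sigma> \<longleftrightarrow> q4 \<noteq> p"
    by (simp_all add: \<Sigma>_def doubleton_eq_iff P51_edges_eq edge_list_def)
  have non_mem: "{U i, V j} \<notin> \<Sigma>" "{U 0, U 1} \<notin> \<Sigma>" "{U 1, U 2} \<notin> \<Sigma>" "{U 2, U 3} \<notin> \<Sigma>" "{U 3, U 4} \<notin> \<Sigma>" for i j
    by (simp_all add: \<Sigma>_def doubleton_eq_iff P51_edges_eq edge_list_def)
  have "negative (pentagon U) \<Sigma> \<longleftrightarrow> p"
    by (simp add: pentagon_def doubleton_eq_iff mem non_mem)
  moreover have "negative (square 0) \<Sigma> \<longleftrightarrow> q0" "negative (square 1) \<Sigma> \<longleftrightarrow> q1"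
    "negative (square 2) \<Sigma> \<longleftrightarrow> q2" "negative (square 3) \<Sigma> \<longleftrightarrow> q3"
    by (simp_all add: square_def doubleton_eq_iff mem non_mem)
  moreover have "negative (square 4) \<Sigma> \<longleftrightarrow> q4"
    by (simp add: square_def doubleton_eq_iff mem non_mem) blast
  ultimately show "holonomy \<Sigma> = (p, [q0, q1, q2, q3, q4])"
    by (simp only: holonomy_def squares_def list.map)
qed

section \<open>The action of the symmetries on holonomies\<close>

text \<open>Adding 4 modulo 5 lowers the index by one: square \<open>i + 1\<close> moves to square
  \<open>i\<close>, and the sign word changes by \<open>rotate1\<close>.\<close>

fun rotation :: "prism_vertex \<Rightarrow> prism_vertex" where
  "rotation (U i) = U ((i + 4) mod 5)"
| "rotation (V i) = V ((i + 4) mod 5)"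

fun swap :: "prism_vertex \<Rightarrow> prism_vertex" where
  "swap (U i) = V i"
| "swap (V i) = U i"

lemma graph_automorphism_rotation: "graph_automorphism P51_verts P51_edges rotation"
  unfolding graph_automorphism_def bij_betw_def
  by (simp add: P51_verts_eq P51_edges_eq edge_list_def doubleton_eq_iff insert_commute One_nat_def[symmetric])

lemma graph_automorphism_swap: "graph_automorphism P51_verts P51_edges swap"
  unfolding graph_automorphism_def bij_betw_def
  by (simp add: P51_verts_eq P51_edges_eq edge_list_def doubleton_eq_iff insert_commute One_nat_def[symmetric])

lemma map_signature_rotation:
  "map_signature rotation (pentagon U) = pentagon U"
  "map_signature rotation (square 0) = square 4"
  "map_signature rotation (square 1) = square 0"
  "map_signature rotation (square 2) = square 1"
  "map_signature rotation (square 3) = square 2"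
  "map_signature rotation (square 4) = square 3"
  by (simp_all add: map_signature_image[OF simple_graph_P51] cycles_subset)
    (simp_all add: pentagon_def square_def insert_commute One_nat_def[symmetric])

lemma map_signature_swap:
  "map_signature swap (pentagon V) = pentagon U"
  "i < 5 \<Longrightarrow> map_signature swap (square i) = square i"
  by (simp_all add: map_signature_image[OF simple_graph_P51] cycles_subset)
    (simp_all add: pentagon_def square_def insert_commute One_nat_def[symmetric])

text \<open>The equation for \<open>C\<close> is a premise so that the entries of the symmetry
  tables can be resolved against it.\<close>

lemma negative_automorphism:
  assumes "graph_automorphism P51_verts P51_edges \<psi>" "\<Sigma> \<subseteq> P51_edges"
    and "map_signature \<psi> D = C" "D \<subseteq> P51_edges"
  shows "negative C (map_signature \<psi> \<Sigma>) \<longleftrightarrow> negative D \<Sigma>"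
  using negative_map_signature[OF simple_graph_P51 assms(1,4,2)] assms(3) by simp

lemma holonomy_rotation:
  assumes "\<Sigma> \<subseteq> P51_edges"
  shows "holonomy (map_signature rotation \<Sigma>) = map_prod id rotate1 (holonomy \<Sigma>)"
  using map_signature_rotation[THEN negative_automorphism[OF graph_automorphism_rotation assms]]
  by (simp add: holonomy_def squares_def cycles_subset)

text \<open>The outer pentagon is the image of the inner one, whose sign is
  \<open>p \<noteq> parity q\<close>, and each square is mapped to itself.\<close>

lemma holonomy_swap:
  assumes "\<Sigma> \<subseteq> P51_edges" "holonomy \<Sigma> = (p, q)"
  shows "holonomy (map_signature swap \<Sigma>) = (p \<noteq> parity q, q)"
  using negative_automorphism[OF graph_automorphism_swap assms(1) map_signature_swap(1)]
    negative_automorphism[OF graph_automorphism_swap assms(1) map_signature_swap(2)]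
    negative_inner_pentagon[of \<Sigma>] assms(2)
  by (auto simp: holonomy_def squares_def cycles_subset)

section \<open>Reduction to twelve representatives and the count\<close>

lemma switching_isomorphism_map_signature:
  assumes "graph_automorphism P51_verts P51_edges \<psi>" "\<Sigma> \<subseteq> P51_edges"
  shows "(\<Sigma>, map_signature \<psi> \<Sigma>) \<in> switching_isomorphism P51_verts P51_edges"
  using assms map_signature_subset[OF simple_graph_P51 assms] switching_equivalent.refl
  unfolding switching_isomorphism_def switching_isomorphic_def signatures_def by blast

lemma switching_isomorphism_if_holonomy_eq:
  assumes "A \<subseteq> P51_edges" "B \<subseteq> P51_edges" "holonomy A = holonomy B"
  shows "(A, B) \<in> switching_isomorphism P51_verts P51_edges"
proof -
  have "map_signature id A = A"
    using map_signature_image[OF simple_graph_P51 assms(1), of id] by simp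
  then show ?thesis
    using switching_equivalent_if_holonomy_eq[OF assms] graph_automorphism_id assms(1,2)
    by (force simp: switching_isomorphism_def switching_isomorphic_def signatures_def)
qed

lemma equiv_P51:
  "equiv (Pow P51_edges) (switching_isomorphism P51_verts P51_edges)"
  using equiv_switching_isomorphism[OF simple_graph_P51] by (simp add: signatures_def)

lemma switching_isomorphism_rotate:
  assumes "\<Sigma> \<subseteq> P51_edges"
  shows "\<exists>\<Sigma>'\<subseteq>P51_edges. (\<Sigma>, \<Sigma>') \<in> switching_isomorphism P51_verts P51_edges \<and>
    holonomy \<Sigma>' = map_prod id (rotate n) (holonomy \<Sigma>)"
proof (induction n)
  case 0
  then show ?case
    using assms switching_isomorphism_if_holonomy_eq[OF assms assms]
    by (auto simp: prod.map_id0 rotate0 id_def intro!: exI[of _ \<Sigma>])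
next
  case (Suc n)
  then obtain \<Sigma>' where \<Sigma>': "\<Sigma>' \<subseteq> P51_edges" "(\<Sigma>, \<Sigma>') \<in> switching_isomorphism P51_verts P51_edges"
    "holonomy \<Sigma>' = map_prod id (rotate n) (holonomy \<Sigma>)" by blast
  let ?\<Sigma> = "map_signature rotation \<Sigma>'"
  have "(\<Sigma>', ?\<Sigma>) \<in> switching_isomorphism P51_verts P51_edges"
    by (rule switching_isomorphism_map_signature[OF graph_automorphism_rotation \<Sigma>'(1)])
  then have "(\<Sigma>, ?\<Sigma>) \<in> switching_isomorphism P51_verts P51_edges"
    using equiv_P51 \<Sigma>'(2) by (meson equivE transD)
  moreover have "holonomy ?\<Sigma> = map_prod id (rotate (Suc n)) (holonomy \<Sigma>)"
    using holonomy_rotation[OF \<Sigma>'(1)] \<Sigma>'(3) by (simp add: map_prod_def split_beta rotate_Suc)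
  ultimately show ?case
    using map_signature_subset[OF simple_graph_P51 graph_automorphism_rotation \<Sigma>'(1)] by blast
qed

text \<open>One word for each rotation orbit of binary words of length five: weights 0 to 5
  contribute 1, 1, 2, 2, 1, 1 orbits.\<close>

definition necklaces :: "bool list list" where
  "necklaces =
     [[False, False, False, False, False], [True, False, False, False, False],
      [True, True, False, False, False], [True, False, True, False, False],
      [True, True, True, False, False], [True, True, False, True, False],
      [True, True, True, True, False], [True, True, True, True, True]]"

text \<open>For odd words the swap exchanges the two values of \<open>p\<close>, so only
  \<open>False\<close> is kept. The four even and four odd necklaces give 4 * 2 + 4 = 12
  pairs.\<close>

definition representatives :: "(bool \<times> bool list) list" where
  "representatives = [(p, q). q \<leftarrow> necklaces, p \<leftarrow> [False, True], \<not> (p \<and> parity q)]"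

lemma representatives_iff: "(p, q) \<in> set representatives \<longleftrightarrow> q \<in> set necklaces \<and> \<not> (p \<and> parity q)"
  by (cases p) (auto simp: representatives_def split: if_splits)

lemma rotate_necklace: "\<exists>n. rotate n [q0, q1, q2, q3, q4] \<in> set necklaces"
proof -
  \<comment> \<open>Five shifts exhaust the rotations, which leaves a check of 32 words.\<close>
  have "\<exists>n\<in>set [0, 1, 2, 3, 4]. rotate n [q0, q1, q2, q3, q4] \<in> set necklaces"
    by (cases q0; cases q1; cases q2; cases q3; cases q4; simp add: necklaces_def rotate_drop_take One_nat_def)
  then show ?thesis by blast
qed

text \<open>A rotation brings the square word to its necklace; a swap then makes the outer pentagon
  positive if the word is odd and that pentagon negative.\<close>

lemma representative_exists:
  assumes "\<Sigma> \<subseteq> P51_edges"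
  shows "\<exists>\<Sigma>'\<subseteq>P51_edges. (\<Sigma>, \<Sigma>') \<in> switching_isomorphism P51_verts P51_edges \<and>
    holonomy \<Sigma>' \<in> set representatives"
proof -
  obtain n where "rotate n (snd (holonomy \<Sigma>)) \<in> set necklaces"
    unfolding holonomy_def squares_def list.map snd_conv using rotate_necklace by blast
  moreover obtain \<Sigma>' where \<Sigma>': "\<Sigma>' \<subseteq> P51_edges"
      "(\<Sigma>, \<Sigma>') \<in> switching_isomorphism P51_verts P51_edges"
      "holonomy \<Sigma>' = map_prod id (rotate n) (holonomy \<Sigma>)"
    using switching_isomorphism_rotate[OF assms, of n] by blast
  moreover obtain p q where h: "holonomy \<Sigma>' = (p, q)" by fastforce
  ultimately have q: "q \<in> set necklaces" by (simp add: map_prod_def split_beta)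
  show ?thesis
  proof (cases "p \<and> parity q")
    case True
    let ?\<Sigma> = "map_signature swap \<Sigma>'"
    have "(\<Sigma>', ?\<Sigma>) \<in> switching_isomorphism P51_verts P51_edges"
      by (rule switching_isomorphism_map_signature[OF graph_automorphism_swap \<Sigma>'(1)])
    then have "(\<Sigma>, ?\<Sigma>) \<in> switching_isomorphism P51_verts P51_edges"
      using equiv_P51 \<Sigma>'(2) by (meson equivE transD)
    moreover have "holonomy ?\<Sigma> = (False, q)"
      using holonomy_swap[OF \<Sigma>'(1) h] True by simp
    then have "holonomy ?\<Sigma> \<in> set representatives"
      using q by (simp add: representatives_iff)
    ultimately show ?thesis
      using map_signature_subset[OF simple_graph_P51 graph_automorphism_swap \<Sigma>'(1)] by blast
  next
    case False
    then have "holonomy \<Sigma>' \<in> set representatives"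
      using h q by (simp add: representatives_iff)
    then show ?thesis using \<Sigma>'(1,2) by blast
  qed
qed

text \<open>The first entry is the weight of the word. The two necklaces of weight 2, and likewise
  of weight 3, have 2 and 4 negative hexagons; for an even word the pentagon count is 0 or 2
  according to \<open>p\<close>.\<close>

lemma distinct_spectrum_representatives: "distinct (map spectrum representatives)"
  by (simp add: representatives_def necklaces_def parity_def spectrum_def)

lemma length_representatives: "length representatives = 12"
  by (simp add: representatives_def necklaces_def parity_def)

lemma representatives_realised:
  assumes "h \<in> set representatives"
  shows "\<exists>\<Sigma>\<subseteq>P51_edges. holonomy \<Sigma> = h"
proof -
  obtain p q where h: "h = (p, q)" by fastforce
  then have "q \<in> set necklaces" using assms by (simp add: representatives_iff)
  then have "\<exists>q0 q1 q2 q3 q4. q = [q0, q1, q2, q3, q4]"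
    by (auto simp: necklaces_def)
  then obtain q0 q1 q2 q3 q4 where "q = [q0, q1, q2, q3, q4]" by blast
  then show ?thesis using holonomy_surj[of p q0 q1 q2 q3 q4] h by simp
qed

theorem theorem7:
  shows "card (signatures P51_edges // switching_isomorphism P51_verts P51_edges) = 12"
proof -
  let ?r = "switching_isomorphism P51_verts P51_edges"
  \<comment> \<open>A section of \<open>holonomy\<close> over the representatives; its values will
    stand for the classes.\<close>
  have "\<exists>\<sigma>. \<forall>h\<in>set representatives. \<sigma> h \<subseteq> P51_edges \<and> holonomy (\<sigma> h) = h"
    using representatives_realised by metis
  then obtain \<sigma> where \<sigma>: "\<And>h. h \<in> set representatives \<Longrightarrow> \<sigma> h \<subseteq> P51_edges"
    "\<And>h. h \<in> set representatives \<Longrightarrow> holonomy (\<sigma> h) = h" by blast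
  have "signatures P51_edges // ?r = (\<lambda>h. ?r `` {\<sigma> h}) ` set representatives"
  proof (intro equalityI subsetI)
    fix X assume "X \<in> signatures P51_edges // ?r"
    then obtain \<Sigma> where "\<Sigma> \<in> signatures P51_edges" and X: "X = ?r `` {\<Sigma>}"
      by (rule quotientE)
    then have \<Sigma>: "\<Sigma> \<subseteq> P51_edges" by (simp add: signatures_def)
    obtain \<Sigma>' where \<Sigma>': "\<Sigma>' \<subseteq> P51_edges" "(\<Sigma>, \<Sigma>') \<in> ?r" "holonomy \<Sigma>' \<in> set representatives"
      using representative_exists[OF \<Sigma>] by blast
    \<comment> \<open>Equal holonomies already give switching equivalence, so the reduced signature
      may be replaced by the chosen one.\<close>
    have "(\<Sigma>', \<sigma> (holonomy \<Sigma>')) \<in> ?r"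
      using \<Sigma>' \<sigma> by (intro switching_isomorphism_if_holonomy_eq) simp_all
    then have "X = ?r `` {\<sigma> (holonomy \<Sigma>')}"
      using X equiv_class_eq[OF equiv_P51] \<Sigma>'(2) by metis
    then show "X \<in> (\<lambda>h. ?r `` {\<sigma> h}) ` set representatives" using \<Sigma>'(3) by blast
  next
    fix X assume "X \<in> (\<lambda>h. ?r `` {\<sigma> h}) ` set representatives"
    then show "X \<in> signatures P51_edges // ?r"
      using \<sigma>(1) by (auto simp: signatures_def intro!: quotientI)
  qed
  moreover have "inj_on (\<lambda>h. ?r `` {\<sigma> h}) (set representatives)"
  proof (rule inj_onI)
    fix h k assume hk: "h \<in> set representatives" "k \<in> set representatives"
      and "?r `` {\<sigma> h} = ?r `` {\<sigma> k}"
    then have "(\<sigma> h, \<sigma> k) \<in> ?r"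
      using eq_equiv_class[OF _ equiv_P51] \<sigma>(1) by blast
    \<comment> \<open>The spectrum is constant on classes and takes distinct values on the
      representatives.\<close>
    then have "spectrum h = spectrum k"
      using spectrum_switching_isomorphism \<sigma>(2) hk by metis
    then show "h = k"
      using distinct_spectrum_representatives hk by (meson distinct_map inj_onD)
  qed
  moreover have "card (set representatives) = 12"
    using distinct_spectrum_representatives length_representatives
    by (metis distinct_card distinct_map)
  ultimately show ?thesis by (simp add: card_image)
qed

end
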